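(* Let $S\subset 2^{<\omega_1}$ be a full-branching Souslin tree, endowed with the order topology of the total order $\prec$ (defined in the context). Let $S^+$ be the set of all $s\in S$ whose domain $o(s)$ is a successor ordinal, let $U$ be the set of all $s\in S^+$ such that $s(\alpha)=0$ where $o(s)=\alpha+1$, and let $V=S^+\setminus U$; give $U$ and $V$ the subspace topologies from $S$. Let $X=\mathbb D(U)$ be the Alexandroff double of $U$. Then the space $X$ is Lindelöf and the space $V$ is hereditarily Lindelöf, but $X\times V$ is not cellular-Lindelöf.
   Context: $2^{<\omega_1}$ is the set of all functions $s:\alpha\to\{0,1\}$ with $\alpha<\omega_1$, ordered by extension ($s\le t$ iff $s\subset t$); $o(s)$ denotes the domain of $s$. A full-branching Souslin tree $S\subset 2^{<\omega_1}$ here is an uncountable subset of $2^{<\omega_1}$ closed under restrictions to initial segments, such that every $s\in S$ has both immediate successors $s^\frown 0$ and $s^\frown 1$ in $S$, and such that $(S,\subset)$ has no uncountable chains and no uncountable antichains (sets of pairwise incomparable elements). For distinct $s,t\in S$, $\Delta(s,t)=\min\{\alpha\in o(s)\cup o(t): s(\alpha)\neq t(\alpha)\}$, where by convention $s(\alpha)\ne t(\alpha)$ if exactly one of $s(\alpha),t(\alpha)$ is defined. For distinct $s,t$, define $s\prec t$ iff $s(\Delta(s,t))=0$ or $t(\Delta(s,t))=1$ (so, in order, value $0$ precedes "undefined", which precedes value $1$); $\prec$ is a dense total order on $S$. The Alexandroff double $\mathbb D(Z)$ of a space $Z$ is the set $Z\times\{0,1\}$ topologized so that $T\subset Z\times\{0,1\}$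 is open if and only if for each $(x,0)\in T$ there is an open subset $W$ of $Z$ with $(x,0)\in (W\times\{0,1\})\setminus\{(x,1)\}\subset T$. A space $Z$ is cellular-Lindelöf if for every family $\mathcal U$ of pairwise disjoint nonempty open subsets of $Z$ there is a Lindelöf subspace $L\subset Z$ such that $L\cap W\neq\emptyset$ for every $W\in\mathcal U$. *)

theory Defs
  imports "HOL-Analysis.Analysis"
begin

text \<open>
  The ordinal \<open>\<omega>\<^sub>1\<close> as a type: its elements are the countable ordinals, realised as the
  well-order \<^term>\<open>cardSuc natLeq\<close>.  An ordinal \<open>\<alpha> < \<omega>\<^sub>1\<close>, regarded as the set of its
  predecessors, is \<open>{..<\<alpha>}\<close>, and \<open>\<alpha> + 1\<close> is \<open>{..\<alpha>}\<close>.
\<close>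

typedef omega1 = "Field (cardSuc natLeq)"
proof -
  have "infinite (Field (cardSuc natLeq))"
    using cardSuc_finite[OF natLeq_Card_order] by (simp add: Field_natLeq)
  then show ?thesis
    by (metis ex_in_conv finite.emptyI)
qed

instantiation omega1 :: wellorder
begin

definition less_eq_omega1 :: "omega1 \<Rightarrow> omega1 \<Rightarrow> bool"
  where "x \<le> y \<longleftrightarrow> (Rep_omega1 x, Rep_omega1 y) \<in> cardSuc natLeq"

definition less_omega1 :: "omega1 \<Rightarrow> omega1 \<Rightarrow> bool"
  where "x < y \<longleftrightarrow> x \<le> y \<and> x \<noteq> (y :: omega1)"

instance
proof -
  have wo: "Well_order (cardSuc natLeq)"
    by (rule cardSuc_Well_order[OF natLeq_Card_order])
  then have refl: "refl_on (Field (cardSuc natLeq)) (cardSuc natLeq)"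
    and trans: "trans (cardSuc natLeq)" and antisym: "antisym (cardSuc natLeq)"
    and total: "Total (cardSuc natLeq)" and wf: "wf (cardSuc natLeq - Id)"
    by (auto simp: order_on_defs)
  have r: "x \<le> x" for x :: omega1
    using refl Rep_omega1[of x] by (auto simp: less_eq_omega1_def refl_on_def)
  have t: "x \<le> z" if "x \<le> y" "y \<le> z" for x y z :: omega1
    using that trans by (auto simp: less_eq_omega1_def trans_def)
  have a: "x = y" if "x \<le> y" "y \<le> x" for x y :: omega1
    using that antisym by (metis less_eq_omega1_def antisym_def Rep_omega1_inject)
  have l: "x \<le> y \<or> y \<le> x" for x y :: omega1
    using total r Rep_omega1[of x] Rep_omega1[of y]
    unfolding less_eq_omega1_def total_on_def by metis
  have w: "P x" if step: "\<And>x. (\<And>y. y < x \<Longrightarrow> P y) \<Longrightarrow> P x" for P and x :: omega1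
  proof -
    have "wf (inv_image (cardSuc natLeq - Id) Rep_omega1)"
      using wf by (rule wf_inv_image)
    moreover have "inv_image (cardSuc natLeq - Id) Rep_omega1 = {(x, y). x < y}"
      by (auto simp: inv_image_def less_omega1_def less_eq_omega1_def Rep_omega1_inject)
    ultimately have "wf {(x::omega1, y). x < y}" by simp
    then show ?thesis
      by (rule wf_induct_rule) (rule step, simp)
  qed
  show "OFCLASS(omega1, wellorder_class)"
  proof
    fix x y z :: omega1 and P :: "omega1 \<Rightarrow> bool"
    show "x < y \<longleftrightarrow> x \<le> y \<and> \<not> y \<le> x"
      using r a by (auto simp: less_omega1_def)
    show "x \<le> x" by (rule r)
    show "x \<le> y \<Longrightarrow> y \<le> z \<Longrightarrow> x \<le> z" by (rule t)
    show "x \<le> y \<Longrightarrow> y \<le> x \<Longrightarrow> x = y" by (rule a)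
    show "x \<le> y \<or> y \<le> x" by (rule l)
    show "P x" if "\<And>x. (\<And>y. y < x \<Longrightarrow> P y) \<Longrightarrow> P x" using that by (rule w)
  qed
qed

end

lemma uncountable_omega1: "uncountable (UNIV :: omega1 set)"
proof
  assume "countable (UNIV :: omega1 set)"
  then have "countable (range Rep_omega1)" by (rule countable_image)
  then have "countable (Field (cardSuc natLeq))"
    by (simp add: type_definition.Rep_range[OF type_definition_omega1])
  then obtain f :: "nat set \<Rightarrow> nat" where "inj_on f (Field (cardSuc natLeq))"
    by (auto simp: countable_def)
  then have "(card_of (Field (cardSuc natLeq)), card_of (UNIV :: nat set)) \<in> ordLeq"
    using card_of_ordLeq[of "Field (cardSuc natLeq)" "UNIV :: nat set"] by blast
  then have "(cardSuc natLeq, natLeq) \<in> ordLeq"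
    by (rule ordIso_ordLeq_trans[OF ordIso_symmetric[OF
          card_of_Field_ordIso[OF cardSuc_Card_order[OF natLeq_Card_order]]]
        ordLeq_ordIso_trans[OF _ card_of_nat]])
  then show False
    by (rule not_ordLess_ordLeq[OF cardSuc_greater[OF natLeq_Card_order], THEN notE])
qed

lemma countable_lessThan_omega1: "countable {..<a :: omega1}"
proof -
  let ?r = "cardSuc natLeq"
  have "(card_of (underS ?r (Rep_omega1 a)), ?r) \<in> ordLess"
    by (rule card_of_underS[OF cardSuc_Card_order[OF natLeq_Card_order] Rep_omega1])
  then have "(card_of (underS ?r (Rep_omega1 a)), natLeq) \<in> ordLeq"
    by (rule cardSuc_ordLeq_ordLess[OF natLeq_Card_order card_of_Card_order, THEN iffD1])
  then have "(card_of (underS ?r (Rep_omega1 a)), card_of (UNIV :: nat set)) \<in> ordLeq"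
    by (rule ordLeq_ordIso_trans[OF _ ordIso_symmetric[OF card_of_nat]])
  then obtain f :: "nat set \<Rightarrow> nat" where "inj_on f (underS ?r (Rep_omega1 a))"
    using card_of_ordLeq[of "underS ?r (Rep_omega1 a)" "UNIV :: nat set"] by blast
  then have c: "countable (underS ?r (Rep_omega1 a))"
    by (auto simp: countable_def)
  have "Rep_omega1 ` {..<a} \<subseteq> underS ?r (Rep_omega1 a)"
    by (auto simp: underS_def less_omega1_def less_eq_omega1_def Rep_omega1_inject)
  then have "countable (Rep_omega1 ` {..<a})" using c by (rule countable_subset)
  then show ?thesis
    by (rule countable_image_inj_on) (simp add: inj_on_def Rep_omega1_inject)
qed

text \<open>
  Elements of \<open>2^{<\<omega>\<^sub>1}\<close> are partial functions on \<^typ>\<open>omega1\<close> whose domain is an ordinal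
  \<open>\<alpha> < \<omega>\<^sub>1\<close>; \<^term>\<open>False\<close> and \<^term>\<open>True\<close> stand for the values \<open>0\<close> and \<open>1\<close>, and extension is
  \<^term>\<open>s \<subseteq>\<^sub>m t\<close>.
\<close>

type_synonym bseq = "omega1 \<Rightarrow> bool option"

definition two_lt_omega1 :: "bseq set"
  where "two_lt_omega1 = {s. \<exists>\<alpha>. dom s = {..<\<alpha>}}"

definition ht :: "bseq \<Rightarrow> omega1"
  where "ht s = (THE \<alpha>. dom s = {..<\<alpha>})"

definition snoc :: "bseq \<Rightarrow> bool \<Rightarrow> bseq"
  where "snoc s i = s(ht s \<mapsto> i)"

definition full_branching_Souslin_tree :: "bseq set \<Rightarrow> bool"
  where "full_branching_Souslin_tree S \<longleftrightarrow>
    S \<subseteq> two_lt_omega1 \<and> uncountable S \<and>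
    (\<forall>s\<in>S. \<forall>\<alpha>. s |` {..<\<alpha>} \<in> S) \<and>
    (\<forall>s\<in>S. snoc s False \<in> S \<and> snoc s True \<in> S) \<and>
    (\<forall>C\<subseteq>S. pairwise (\<lambda>s t. s \<subseteq>\<^sub>m t \<or> t \<subseteq>\<^sub>m s) C \<longrightarrow> countable C) \<and>
    (\<forall>A\<subseteq>S. pairwise (\<lambda>s t. \<not> s \<subseteq>\<^sub>m t \<and> \<not> t \<subseteq>\<^sub>m s) A \<longrightarrow> countable A)"

text \<open>
  Since \<open>s \<alpha> = None\<close> means that \<open>s(\<alpha>)\<close> is undefined, \<open>s \<alpha> \<noteq> t \<alpha>\<close> also holds when exactly
  one of the two values is defined.
\<close>

definition Delta :: "bseq \<Rightarrow> bseq \<Rightarrow> omega1"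
  where "Delta s t = (LEAST \<alpha>. \<alpha> \<in> dom s \<union> dom t \<and> s \<alpha> \<noteq> t \<alpha>)"

definition prec :: "bseq \<Rightarrow> bseq \<Rightarrow> bool"  (infix "\<prec>" 50)
  where "s \<prec> t \<longleftrightarrow>
    s \<noteq> t \<and> (s (Delta s t) = Some False \<or> t (Delta s t) = Some True)"

text \<open>The order topology on \<open>A\<close> of a strict total order \<open>r\<close>, generated by the open rays.\<close>

definition order_topology_on :: "'a set \<Rightarrow> ('a \<Rightarrow> 'a \<Rightarrow> bool) \<Rightarrow> 'a topology"
  where "order_topology_on A r = topology_generated_by
    (insert A ((\<lambda>a. {x \<in> A. r a x}) ` A \<union> (\<lambda>a. {x \<in> A. r x a}) ` A))"

text \<open>The elements whose domain is a successor ordinal \<open>\<alpha> + 1\<close>.\<close>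

definition succ_part :: "bseq set \<Rightarrow> bseq set"
  where "succ_part S = {s \<in> S. \<exists>\<alpha>. dom s = {..\<alpha>}}"

definition U_part :: "bseq set \<Rightarrow> bseq set"
  where "U_part S = {s \<in> succ_part S. \<exists>\<alpha>. dom s = {..\<alpha>} \<and> s \<alpha> = Some False}"

definition V_part :: "bseq set \<Rightarrow> bseq set"
  where "V_part S = succ_part S - U_part S"

text \<open>The second components \<^term>\<open>False\<close> and \<^term>\<open>True\<close> stand for \<open>0\<close> and \<open>1\<close>.\<close>

definition Alexandroff_double :: "'a topology \<Rightarrow> ('a \<times> bool) topology"
  where "Alexandroff_double Z = topology (\<lambda>T. T \<subseteq> topspace Z \<times> UNIV \<and>
    (\<forall>x. (x, False) \<in> T \<longrightarrow>
      (\<exists>W. openin Z W \<and> (x, False) \<in> (W \<times> UNIV) - {(x, True)} \<and>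
           (W \<times> UNIV) - {(x, True)} \<subseteq> T)))"

lemma openin_Alexandroff_double:
  "openin (Alexandroff_double Z) T \<longleftrightarrow> T \<subseteq> topspace Z \<times> UNIV \<and>
    (\<forall>x. (x, False) \<in> T \<longrightarrow>
      (\<exists>W. openin Z W \<and> (x, False) \<in> (W \<times> UNIV) - {(x, True)} \<and>
           (W \<times> UNIV) - {(x, True)} \<subseteq> T))"
proof -
  define N where "N = (\<lambda>T x. \<exists>W. openin Z W \<and> (x, False) \<in> (W \<times> UNIV) - {(x, True)} \<and>
           (W \<times> UNIV) - {(x, True)} \<subseteq> (T :: ('a \<times> bool) set))"
  define P where "P = (\<lambda>T. T \<subseteq> topspace Z \<times> UNIV \<and> (\<forall>x. (x, False) \<in> T \<longrightarrow> N T x))"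
  have N_Int: "N (A \<inter> B) x" if A: "N A x" and B: "N B x" for A B x
  proof -
    obtain W where "openin Z W" "x \<in> W" "(W \<times> UNIV) - {(x, True)} \<subseteq> A"
      using A unfolding N_def by auto
    moreover obtain W' where "openin Z W'" "x \<in> W'" "(W' \<times> UNIV) - {(x, True)} \<subseteq> B"
      using B unfolding N_def by auto
    ultimately show ?thesis
      unfolding N_def by (intro exI[of _ "W \<inter> W'"]) auto
  qed
  have N_mono: "N B x" if "N A x" "A \<subseteq> B" for A B x
    using that unfolding N_def by (meson subset_trans)
  have "P (A \<inter> B)" if "P A" "P B" for A B
    using that N_Int unfolding P_def by (simp add: le_infI1)
  moreover have "P (\<Union>K)" if K: "\<forall>A\<in>K. P A" for K
    unfolding P_def
  proof (intro conjI allI impI)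
    show "\<Union>K \<subseteq> topspace Z \<times> UNIV" using K unfolding P_def by (simp add: Sup_le_iff)
    fix x assume "(x, False) \<in> \<Union>K"
    then obtain A where A: "A \<in> K" "(x, False) \<in> A" by (rule UnionE)
    then have "N A x" using K unfolding P_def by simp
    then show "N (\<Union>K) x" using A(1) by (rule N_mono[OF _ Union_upper])
  qed
  ultimately have "istopology P"
    unfolding istopology_def by simp
  then have "openin (topology P) = P"
    by (rule topology_inverse')
  then show ?thesis
    unfolding Alexandroff_double_def P_def N_def by (rule fun_cong)
qed

definition cellular_Lindelof_space :: "'a topology \<Rightarrow> bool"
  where "cellular_Lindelof_space Z \<longleftrightarrow>
    (\<forall>\<U>. (\<forall>W\<in>\<U>. openin Z W \<and> W \<noteq> {}) \<and> pairwise disjnt \<U> \<longrightarrow>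
      (\<exists>L\<subseteq>topspace Z. Lindelof_space (subtopology Z L) \<and> (\<forall>W\<in>\<U>. L \<inter> W \<noteq> {})))"

end

theory Submission
  imports Defs
begin

text \<open>
  Cones of the tree are open convex sets. Consider minimal nodes whose cones lie in a single member
  of a cover by open sets: they form an antichain, so there are countably many, and every covered
  point outside their cones is an initial segment of one of them. Hence every subspace of the tree
  is Lindelof, and the Alexandroff double inherits this from its base.

  The cellular family is \<open>{(s0, 1)} \<times> (V \<inter> cone s)\<close> for \<open>s \<in> S\<close>. If \<open>u0\<close> (or \<open>u1\<close>) tends to
  \<open>s\<close>, then so does the whole cone of \<open>u\<close>. The points chosen from the family can therefore
  accumulate only on the diagonal, which \<open>U \<times> V\<close> does not meet.
\<close>

section \<open>The lexicographic order and its converse\<close>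

text \<open>The bit \<open>i\<close> selects the direction, so that left-right symmetric facts are proved once:
  \<open>lex_less True\<close> is the order \<open>\<prec>\<close> and \<open>lex_less False\<close> its converse.\<close>

definition lex_less :: "bool \<Rightarrow> bseq \<Rightarrow> bseq \<Rightarrow> bool"
  where "lex_less i s t \<longleftrightarrow>
    (\<exists>\<delta>. (\<forall>\<beta><\<delta>. s \<beta> = t \<beta>) \<and> s \<delta> \<noteq> t \<delta> \<and> (s \<delta> = Some (\<not> i) \<or> t \<delta> = Some i))"

lemma lexI:
  assumes "\<And>\<beta>. \<beta> < \<delta> \<Longrightarrow> s \<beta> = t \<beta>" "s \<delta> \<noteq> t \<delta>" "s \<delta> = Some (\<not> i) \<or> t \<delta> = Some i"
  shows "lex_less i s t"
  using assms unfolding lex_less_def by blast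

lemma lexE:
  assumes "lex_less i s t"
  obtains \<delta> where "\<And>\<beta>. \<beta> < \<delta> \<Longrightarrow> s \<beta> = t \<beta>" "s \<delta> \<noteq> t \<delta>" "s \<delta> = Some (\<not> i) \<or> t \<delta> = Some i"
  using assms unfolding lex_less_def by blast

lemma first_difference:
  fixes s t :: bseq
  assumes "s \<noteq> t"
  obtains \<delta> where "\<And>\<beta>. \<beta> < \<delta> \<Longrightarrow> s \<beta> = t \<beta>" "s \<delta> \<noteq> t \<delta>"
proof -
  from assms have "\<exists>\<alpha>. s \<alpha> \<noteq> t \<alpha>" by auto
  then obtain \<delta> where "s \<delta> \<noteq> t \<delta>" "\<forall>\<beta><\<delta>. s \<beta> = t \<beta>"
    using exists_least_iff[of "\<lambda>\<alpha>. s \<alpha> \<noteq> t \<alpha>"] by auto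
  then show ?thesis using that by blast
qed

lemma Delta_eq:
  assumes "\<And>\<beta>. \<beta> < \<delta> \<Longrightarrow> s \<beta> = t \<beta>" "s \<delta> \<noteq> t \<delta>"
  shows "Delta s t = \<delta>"
  unfolding Delta_def
proof (rule Least_equality)
  show "\<delta> \<in> dom s \<union> dom t \<and> s \<delta> \<noteq> t \<delta>"
    using assms(2) by auto
  show "\<delta> \<le> \<beta>" if "\<beta> \<in> dom s \<union> dom t \<and> s \<beta> \<noteq> t \<beta>" for \<beta>
    using that assms(1) by (meson not_le)
qed

lemma prec_eq_lex: "(\<prec>) = lex_less True"
proof (intro ext iffI)
  fix s t
  assume st: "prec s t"
  then obtain \<delta> where d: "\<And>\<beta>. \<beta> < \<delta> \<Longrightarrow> s \<beta> = t \<beta>" "s \<delta> \<noteq> t \<delta>"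
    unfolding prec_def using first_difference by blast
  with st show "lex_less True s t"
    using lexI[of \<delta> s t True] Delta_eq[of \<delta> s t] unfolding prec_def by auto
next
  fix s t
  assume "lex_less True s t"
  then show "prec s t"
    by (rule lexE) (use Delta_eq[of _ s t] in \<open>auto simp: prec_def\<close>)
qed

text \<open>As a rewrite rule this fires only on a syntactic negation. A literal
  \<open>\<not> True\<close> is normalised to \<open>False\<close> first, so proofs about the
  concrete order quote the instance \<open>lex_not[of True]\<close>.\<close>

lemma lex_not [simp]: "lex_less (\<not> i) s t = lex_less i t s"
  unfolding lex_less_def by (simp add: eq_commute[of "s _" "t _"] disj_commute)

lemma lex_irrefl [simp]: "\<not> lex_less i s s"
  unfolding lex_less_def by auto

lemma lex_total: "s \<noteq> t \<Longrightarrow> lex_less i s t \<or> lex_less i t s"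
proof -
  assume "s \<noteq> t"
  then obtain \<delta> where d: "\<And>\<beta>. \<beta> < \<delta> \<Longrightarrow> s \<beta> = t \<beta>" "s \<delta> \<noteq> t \<delta>"
    by (rule first_difference) blast
  then show ?thesis
    using lexI[of \<delta> s t i] lexI[of \<delta> t s i] by (cases "s \<delta>"; cases "t \<delta>") auto
qed

text \<open>The smaller of the two first differences decides. If both coincide, the alternatives at
  that index leave only the value \<open>\<not> i\<close> for \<open>s\<close> and \<open>i\<close>
  for \<open>u\<close>.\<close>

lemma lex_trans:
  assumes "lex_less i s t" "lex_less i t u"
  shows "lex_less i s u"
proof -
  obtain \<delta> where d: "\<And>\<beta>. \<beta> < \<delta> \<Longrightarrow> s \<beta> = t \<beta>" "s \<delta> \<noteq> t \<delta>" "s \<delta> = Some (\<not> i) \<or> t \<delta> = Some i"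
    using assms(1) by (rule lexE) blast
  obtain \<epsilon> where e: "\<And>\<beta>. \<beta> < \<epsilon> \<Longrightarrow> t \<beta> = u \<beta>" "t \<epsilon> \<noteq> u \<epsilon>" "t \<epsilon> = Some (\<not> i) \<or> u \<epsilon> = Some i"
    using assms(2) by (rule lexE) blast
  show ?thesis
  proof (rule lexI[where \<delta> = "min \<delta> \<epsilon>"])
    show "s \<beta> = u \<beta>" if "\<beta> < min \<delta> \<epsilon>" for \<beta> using that d(1) e(1) by simp
    have "s (min \<delta> \<epsilon>) \<noteq> u (min \<delta> \<epsilon>) \<and> (s (min \<delta> \<epsilon>) = Some (\<not> i) \<or> u (min \<delta> \<epsilon>) = Some i)"
    proof (cases \<delta> \<epsilon> rule: linorder_cases)
      case less
      then show ?thesis using d e(1)[of \<delta>] by (auto simp: min_def)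
    next
      case equal
      then show ?thesis using d e by auto
    next
      case greater
      then show ?thesis using e d(1)[of \<epsilon>] by (auto simp: min_def)
    qed
    then show "s (min \<delta> \<epsilon>) \<noteq> u (min \<delta> \<epsilon>)" "s (min \<delta> \<epsilon>) = Some (\<not> i) \<or> u (min \<delta> \<epsilon>) = Some i"
      by auto
  qed
qed

lemma lex_asym: "lex_less i s t \<Longrightarrow> \<not> lex_less i t s"
  using lex_trans lex_irrefl by blast

text \<open>The witness is the later of \<open>a\<close> and \<open>c\<close> in direction
  \<open>i\<close>. It serves to intersect intervals; bit \<open>False\<close> handles their upper
  ends.\<close>

lemma ex_tighter_bound:
  assumes "lex_less i a x" "lex_less i c x"
  shows "\<exists>l\<in>{a, c}. lex_less i l x \<and> (\<forall>y. lex_less i l y \<longrightarrow> lex_less i a y \<and> lex_less i c y)"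
proof -
  consider "a = c" | "lex_less i a c" | "lex_less i c a"
    using lex_total[of a c i] by blast
  then show ?thesis
  proof cases
    case 1
    then show ?thesis using assms by simp
  next
    case 2
    then show ?thesis using assms(2) lex_trans[OF 2] by simp
  next
    case 3
    then show ?thesis using assms(1) lex_trans[OF 3] by simp
  qed
qed

section \<open>Heights, initial segments and cones\<close>

lemma snoc_apply: "snoc s i \<beta> = (if \<beta> = ht s then Some i else s \<beta>)"
  by (simp add: snoc_def)

lemma ht_eqI: "dom s = {..<\<alpha>} \<Longrightarrow> ht s = \<alpha>"
  unfolding ht_def by (rule the_equality) auto

lemma apply_eq_None_iff: "s \<in> two_lt_omega1 \<Longrightarrow> s \<beta> = None \<longleftrightarrow> ht s \<le> \<beta>"
proof -
  assume "s \<in> two_lt_omega1"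
  then obtain \<alpha> where a: "dom s = {..<\<alpha>}" unfolding two_lt_omega1_def by blast
  then have "s \<beta> = None \<longleftrightarrow> \<beta> \<notin> {..<\<alpha>}" by (metis domIff)
  then show ?thesis using ht_eqI[OF a] by auto
qed

lemma apply_eqI_map_le: "s \<subseteq>\<^sub>m t \<Longrightarrow> s \<beta> \<noteq> None \<Longrightarrow> s \<beta> = t \<beta>"
  by (auto simp: map_le_def)

lemma map_le_iff_restrict:
  assumes "s \<in> two_lt_omega1"
  shows "s \<subseteq>\<^sub>m t \<longleftrightarrow> (\<forall>\<beta> < ht s. s \<beta> = t \<beta>)"
  using apply_eq_None_iff[OF assms] by (auto simp: map_le_def dom_def not_le)

lemma restrict_eq_if_map_le:
  assumes "s \<in> two_lt_omega1" "s \<subseteq>\<^sub>m t"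
  shows "s = t |` {..<ht s}"
proof
  fix \<beta>
  show "s \<beta> = (t |` {..<ht s}) \<beta>"
    using assms apply_eq_None_iff[OF assms(1), of \<beta>] map_le_iff_restrict[OF assms(1)]
    by (cases "\<beta> < ht s") (auto simp: restrict_map_def)
qed

lemma map_le_linear:
  assumes "s \<in> two_lt_omega1" "t \<in> two_lt_omega1" "s \<subseteq>\<^sub>m x" "t \<subseteq>\<^sub>m x"
  shows "s \<subseteq>\<^sub>m t \<or> t \<subseteq>\<^sub>m s"
proof (cases "ht s \<le> ht t")
  case True
  then have "s \<subseteq>\<^sub>m t"
    using assms by (metis map_le_iff_restrict order_less_le_trans)
  then show ?thesis ..
next
  case False
  then have "t \<subseteq>\<^sub>m s"
    using assms by (metis map_le_iff_restrict order_less_trans linorder_not_le)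
  then show ?thesis ..
qed

lemma map_le_snoc: "s \<in> two_lt_omega1 \<Longrightarrow> s \<subseteq>\<^sub>m snoc s i"
  by (simp add: map_le_iff_restrict snoc_apply)

text \<open>"Undefined" lies between the two values: at \<open>ht s\<close> the node
  \<open>s\<close> is undefined, whereas every extension of \<open>snoc s i\<close> has the value
  \<open>i\<close> there.\<close>

lemma lex_snoc:
  assumes "s \<in> two_lt_omega1" "snoc s i \<subseteq>\<^sub>m x"
  shows "lex_less i s x"
proof (rule lexI[where \<delta> = "ht s"])
  have "s \<subseteq>\<^sub>m x" using map_le_snoc[OF assms(1)] assms(2) by (rule map_le_trans)
  then show "s \<beta> = x \<beta>" if "\<beta> < ht s" for \<beta>
    using that map_le_iff_restrict[OF assms(1)] by blast
  have "x (ht s) = Some i"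
    using apply_eqI_map_le[OF assms(2), of "ht s"] by (simp add: snoc_apply)
  moreover have "s (ht s) = None"
    using apply_eq_None_iff[OF assms(1), of "ht s"] by simp
  ultimately show "s (ht s) \<noteq> x (ht s)" "s (ht s) = Some (\<not> i) \<or> x (ht s) = Some i"
    by simp_all
qed

text \<open>Convexity of cones: since \<open>t\<close> lies outside the cone of \<open>u\<close>,
  its first difference from \<open>x\<close> occurs below \<open>ht u\<close>, where
  \<open>x\<close> and \<open>y\<close> both agree with \<open>u\<close>.\<close>

lemma lex_cone:
  assumes "u \<in> two_lt_omega1" "u \<subseteq>\<^sub>m x" "u \<subseteq>\<^sub>m y" "\<not> u \<subseteq>\<^sub>m t" "lex_less i x t"
  shows "lex_less i y t"
  using assms(5)
proof (rule lexE)
  fix \<delta>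
  assume d: "\<And>\<beta>. \<beta> < \<delta> \<Longrightarrow> x \<beta> = t \<beta>" "x \<delta> \<noteq> t \<delta>" "x \<delta> = Some (\<not> i) \<or> t \<delta> = Some i"
  have "\<delta> < ht u"
    using d(1) assms(1,2,4) by (metis map_le_iff_restrict linorder_not_le order_less_le_trans)
  then have "x \<beta> = y \<beta>" if "\<beta> \<le> \<delta>" for \<beta>
    using that assms(1-3) by (metis map_le_iff_restrict order_le_less_trans)
  then show ?thesis
    using d by (intro lexI[where \<delta> = \<delta>]) auto
qed

section \<open>One-sided bounds in the tree\<close>

locale branching_tree =
  fixes S :: "bseq set"
  assumes sub: "S \<subseteq> two_lt_omega1"
    and restrict: "s \<in> S \<Longrightarrow> s |` {..<\<alpha>} \<in> S"
    and snoc: "s \<in> S \<Longrightarrow> snoc s i \<in> S"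
begin

definition cone :: "bseq \<Rightarrow> bseq set"
  where "cone t = {x \<in> S. t \<subseteq>\<^sub>m x}"

lemma two_lt: "s \<in> S \<Longrightarrow> s \<in> two_lt_omega1"
  using sub by blast

text \<open>The bound \<open>t\<close> is either \<open>snoc s i\<close> or the first point at which the branch that starts
  with \<open>snoc s i\<close> and continues with the value \<open>\<not> i\<close> leaves \<open>b\<close>; along this branch the tree
  converges to \<open>s\<close>.\<close>

lemma ex_one_sided_bound:
  assumes s: "s \<in> S" and b: "b \<in> S" and sb: "lex_less i s b"
  shows "\<exists>t\<in>S. snoc s i \<subseteq>\<^sub>m t \<and> (\<forall>\<beta>>ht s. t \<beta> \<noteq> None \<longrightarrow> t \<beta> = Some (\<not> i)) \<and>
    (\<forall>x. t \<subseteq>\<^sub>m x \<longrightarrow> lex_less i x b)"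
proof (cases "snoc s i \<subseteq>\<^sub>m b")
  \<comment> \<open>With \<open>b\<close> outside the cone of \<open>snoc s i\<close>, this whole
    cone precedes \<open>b\<close> in direction \<open>i\<close>, so \<open>snoc s i\<close> itself
    serves as \<open>t\<close>.\<close>
  case False
  have "lex_less i x b" if x: "snoc s i \<subseteq>\<^sub>m x" for x
  proof -
    have "s \<subseteq>\<^sub>m x" using map_le_snoc[OF two_lt[OF s]] x by (rule map_le_trans)
    have "lex_less i x b" if "\<not> s \<subseteq>\<^sub>m b"
      using lex_cone[OF two_lt[OF s] _ \<open>s \<subseteq>\<^sub>m x\<close> that sb] by simp
    \<comment> \<open>An extension \<open>b\<close> of \<open>s\<close> lying beyond
      \<open>s\<close> in direction \<open>i\<close> would have the value \<open>i\<close> at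
      \<open>ht s\<close> and hence extend \<open>snoc s i\<close>, which this case
      excludes.\<close>
    moreover have "\<not> s \<subseteq>\<^sub>m b"
    proof
      assume "s \<subseteq>\<^sub>m b"
      then have eq: "s \<beta> = b \<beta>" if "\<beta> < ht s" for \<beta>
        using that map_le_iff_restrict two_lt s by blast
      obtain \<delta> where d: "\<And>\<beta>. \<beta> < \<delta> \<Longrightarrow> s \<beta> = b \<beta>" "s \<delta> \<noteq> b \<delta>" "s \<delta> = Some (\<not> i) \<or> b \<delta> = Some i"
        using sb by (rule lexE) blast
      have "ht s \<le> \<delta>" using eq d(2) by (meson linorder_not_le)
      then have N: "s \<delta> = None" using apply_eq_None_iff two_lt s by blast
      \<comment> \<open>Domains have no gaps: were \<open>b\<close> undefined at
        \<open>ht s\<close>, it would also be undefined at \<delta> and agree there with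
        \<open>s\<close>.\<close>
      have "\<delta> = ht s"
      proof (rule ccontr)
        assume "\<delta> \<noteq> ht s"
        then have "s (ht s) = b (ht s)" using d(1) \<open>ht s \<le> \<delta>\<close> by simp
        then have "ht b \<le> ht s" using apply_eq_None_iff two_lt s b by (metis order_refl)
        then have "b \<delta> = None" using apply_eq_None_iff two_lt b \<open>ht s \<le> \<delta>\<close> by (meson order_trans)
        then show False using N d(2) by simp
      qed
      then have "b (ht s) = Some i" using d N by simp
      then have "snoc s i \<subseteq>\<^sub>m b"
        using eq apply_eq_None_iff[OF two_lt[OF s]]
        by (auto simp: map_le_def snoc_apply) (metis linorder_not_le option.distinct(1))
      then show False using False by simp
    qed
    ultimately show ?thesis by blast
  qed
  moreover have "snoc s i \<beta> = None" if "\<beta> > ht s" for \<beta>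
    using that apply_eq_None_iff[OF two_lt[OF s], of \<beta>] by (auto simp: snoc_apply)
  ultimately show ?thesis
    using snoc[OF s] by (intro bexI[of _ "snoc s i"]) auto
next
  case True
  \<comment> \<open>The index at which the branch leaves \<open>b\<close> is the least one
    satisfying \<open>P\<close>; it exists because \<open>b\<close> is undefined at
    \<open>ht b\<close>. Placing \<open>\<not> i\<close> there puts \<open>t\<close> and its cone
    before \<open>b\<close> in direction \<open>i\<close>.\<close>
  define P where "P = (\<lambda>\<alpha>. ht s < \<alpha> \<and> b \<alpha> \<noteq> Some (\<not> i))"
  have bs: "b (ht s) = Some i"
    using apply_eqI_map_le[OF True, of "ht s"] by (simp add: snoc_apply)
  then have "ht s < ht b" using apply_eq_None_iff[OF two_lt[OF b], of "ht s"] by (simp add: not_le)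
  moreover have "b (ht b) = None" using apply_eq_None_iff[OF two_lt[OF b]] by simp
  ultimately have "P (ht b)" unfolding P_def by simp
  then obtain \<alpha> where a: "P \<alpha>" "\<forall>\<beta><\<alpha>. \<not> P \<beta>" "\<alpha> \<le> ht b"
    using exists_least_iff[of P] by (metis linorder_not_le)
  define y where "y = b |` {..<\<alpha>}"
  have y: "y \<in> S" using restrict[OF b] unfolding y_def by simp
  have "y \<beta> \<noteq> None \<longleftrightarrow> \<beta> < \<alpha>" for \<beta>
    using a(3) apply_eq_None_iff[OF two_lt[OF b], of \<beta>] unfolding y_def
    by (auto simp: restrict_map_def)
  then have "dom y = {..<\<alpha>}" unfolding dom_def by auto
  then have hy: "ht y = \<alpha>" by (rule ht_eqI)
  have t: "snoc y (\<not> i) \<beta> = (if \<beta> < \<alpha> then b \<beta> else if \<beta> = \<alpha> then Some (\<not> i) else None)" for \<beta>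
    unfolding snoc_apply hy by (auto simp: y_def restrict_map_def)
  have dom_si: "snoc s i \<beta> = None" if "\<beta> > ht s" for \<beta>
    using that apply_eq_None_iff[OF two_lt[OF s], of \<beta>] by (auto simp: snoc_apply)
  have "snoc s i \<subseteq>\<^sub>m snoc y (\<not> i)"
    unfolding map_le_def
  proof
    fix \<beta> assume "\<beta> \<in> dom (snoc s i)"
    then have "\<beta> \<le> ht s" using dom_si by (meson domIff linorder_not_le)
    then have "\<beta> < \<alpha>" using a(1) unfolding P_def by auto
    then show "snoc s i \<beta> = snoc y (\<not> i) \<beta>"
      using apply_eqI_map_le[OF True, of \<beta>] \<open>\<beta> \<in> dom (snoc s i)\<close> t by (simp add: domIff)
  qed
  moreover have "snoc y (\<not> i) \<beta> = Some (\<not> i)" if "\<beta> > ht s" "snoc y (\<not> i) \<beta> \<noteq> None" for \<beta>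
    using that a(2) t[of \<beta>] unfolding P_def by (auto split: if_splits)
  moreover have "lex_less i x b" if "snoc y (\<not> i) \<subseteq>\<^sub>m x" for x
  proof (rule lexI[where \<delta> = \<alpha>])
    show "x \<beta> = b \<beta>" if "\<beta> < \<alpha>" for \<beta>
    proof -
      have "b \<beta> \<noteq> None" using that a(3) apply_eq_None_iff[OF two_lt[OF b], of \<beta>] by simp
      then show ?thesis using apply_eqI_map_le[OF \<open>snoc y (\<not> i) \<subseteq>\<^sub>m x\<close>, of \<beta>] t[of \<beta>] that by simp
    qed
    have "x \<alpha> = Some (\<not> i)"
      using apply_eqI_map_le[OF \<open>snoc y (\<not> i) \<subseteq>\<^sub>m x\<close>, of \<alpha>] t[of \<alpha>] by simp
    then show "x \<alpha> \<noteq> b \<alpha>" "x \<alpha> = Some (\<not> i) \<or> b \<alpha> = Some i"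
      using a(1) unfolding P_def by auto
  qed
  ultimately show ?thesis
    using snoc[OF y] by (intro bexI[of _ "snoc y (\<not> i)"]) auto
qed

text \<open>Beyond \<open>ht s\<close> the bound \<open>t\<close> never takes the value
  \<open>i\<close>. So \<open>snoc u j\<close> can precede \<open>t\<close> only by carrying
  \<open>\<not> i\<close> at their first difference, an index above \<open>ht s\<close> and at most
  \<open>ht u\<close>. Hence \<open>u\<close> already extends \<open>snoc s i\<close>, and its whole
  cone lies beyond \<open>s\<close>. That the cone precedes \<open>b\<close> follows from convexity,
  or from \<open>tb\<close> if \<open>u\<close> is an initial segment of \<open>t\<close>.\<close>

lemma snoc_between_imp_cone_between:
  assumes s: "s \<in> S" and t: "t \<in> S" "snoc s i \<subseteq>\<^sub>m t"
    and alt: "\<And>\<beta>. ht s < \<beta> \<Longrightarrow> t \<beta> \<noteq> None \<Longrightarrow> t \<beta> = Some (\<not> i)"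
    and tb: "\<And>x. t \<subseteq>\<^sub>m x \<Longrightarrow> lex_less i x b"
    and u: "u \<in> S" "lex_less i s (snoc u j)" "lex_less i (snoc u j) t" and x: "u \<subseteq>\<^sub>m x"
  shows "lex_less i s x \<and> lex_less i x b"
proof -
  note s2 = two_lt[OF s] and t2 = two_lt[OF t(1)] and u2 = two_lt[OF u(1)]
  have uN: "snoc u j \<beta> = None \<longleftrightarrow> ht u < \<beta>" for \<beta>
    using apply_eq_None_iff[OF u2, of \<beta>] by (auto simp: snoc_apply)
  have st: "s \<subseteq>\<^sub>m t" using map_le_snoc[OF s2] t(2) by (rule map_le_trans)
  \<comment> \<open>Otherwise convexity of the cone of \<open>s\<close> would let \<open>t\<close>
    replace \<open>s\<close> and put \<open>t\<close> before \<open>snoc u j\<close>.\<close>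
  have su: "s \<subseteq>\<^sub>m snoc u j"
    using lex_cone[OF s2 _ st _ u(2)] lex_asym[OF u(3)] by auto
  have eq: "s \<beta> = snoc u j \<beta>" if "\<beta> < ht s" for \<beta>
    using that su map_le_iff_restrict[OF s2] by blast
  have us: "snoc u j (ht s) = Some i"
    using u(2)
  proof (rule lexE)
    fix \<delta>
    assume d: "\<And>\<beta>. \<beta> < \<delta> \<Longrightarrow> s \<beta> = snoc u j \<beta>" "s \<delta> \<noteq> snoc u j \<delta>"
      "s \<delta> = Some (\<not> i) \<or> snoc u j \<delta> = Some i"
    have ge: "ht s \<le> \<delta>" using eq d(2) by (meson linorder_not_le)
    then have N: "s \<delta> = None" using apply_eq_None_iff[OF s2] by simp
    then have "\<delta> \<le> ht u" using uN d by (metis linorder_not_le)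
    then have "snoc u j (ht s) \<noteq> None" using uN ge by (meson order_trans linorder_not_le)
    moreover have "s (ht s) = None" using apply_eq_None_iff[OF s2] by simp
    ultimately have "\<delta> = ht s" using d(1)[of "ht s"] ge by force
    then show ?thesis using d N by simp
  qed
  obtain \<delta> where d: "\<And>\<beta>. \<beta> < \<delta> \<Longrightarrow> snoc u j \<beta> = t \<beta>" "snoc u j \<delta> \<noteq> t \<delta>"
    "snoc u j \<delta> = Some (\<not> i) \<or> t \<delta> = Some i"
    using u(3) by (rule lexE) blast
  have ts: "t \<beta> = snoc u j \<beta>" if "\<beta> \<le> ht s" for \<beta>
  proof (cases "\<beta> = ht s")
    case True
    then show ?thesis using apply_eqI_map_le[OF t(2), of "ht s"] us by (simp add: snoc_apply)
  next
    case False
    then show ?thesis using that eq st map_le_iff_restrict[OF s2] by (metis le_neq_trans)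
  qed
  then have ds: "ht s < \<delta>" using d(2) by (metis linorder_not_le)
  have tn: "t \<delta> \<noteq> Some i" using alt[OF ds] by auto
  then have ud: "snoc u j \<delta> = Some (\<not> i)" using d(3) by simp
  then have du: "\<delta> \<le> ht u" using uN by (metis linorder_not_le option.distinct(1))
  then have hs: "ht s < ht u" using ds by simp
  have ueq: "u \<beta> = x \<beta>" if "\<beta> < ht u" for \<beta>
    using that x map_le_iff_restrict[OF u2] by blast
  have "lex_less i s x"
  proof (rule lexI[where \<delta> = "ht s"])
    show "s \<beta> = x \<beta>" if "\<beta> < ht s" for \<beta>
      using eq[OF that] ueq[of \<beta>] order.strict_trans[OF that hs] by (auto simp: snoc_apply)
    have "x (ht s) = Some i" using us ueq[OF hs] order.strict_implies_not_eq[OF hs] by (simp add: snoc_apply)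
    moreover have "s (ht s) = None" using apply_eq_None_iff[OF s2] by simp
    ultimately show "s (ht s) \<noteq> x (ht s)" "s (ht s) = Some (\<not> i) \<or> x (ht s) = Some i" by auto
  qed
  moreover have "lex_less i x b"
  proof (cases "u \<subseteq>\<^sub>m t")
    case False
    have "lex_less i x t"
      using lex_cone[OF u2 map_le_snoc[OF u2] x False u(3)] .
    then show ?thesis using tb[OF map_le_refl] by (rule lex_trans)
  next
    \<comment> \<open>The first difference is now at \<open>ht u\<close>, where \<open>t\<close> can
      only be undefined. So \<open>t\<close> ends no later than \<open>u\<close>, and every
      extension of \<open>u\<close> extends \<open>t\<close>.\<close>
    case True
    then have "u \<beta> = t \<beta>" if "\<beta> < ht u" for \<beta>
      using that map_le_iff_restrict[OF u2] by blast
    then have "\<delta> = ht u" using d(2) du by (auto simp: snoc_apply split: if_splits)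
    then have "t (ht u) = None" using alt[OF ds] ud d(2) by metis
    then have "ht t \<le> ht u" using apply_eq_None_iff[OF t2] by simp
    then have "t \<subseteq>\<^sub>m x"
      using map_le_iff_restrict[OF t2] \<open>\<And>\<beta>. \<beta> < ht u \<Longrightarrow> u \<beta> = t \<beta>\<close> ueq
      by (metis order_less_le_trans)
    then show ?thesis by (rule tb)
  qed
  ultimately show ?thesis ..
qed

text \<open>Combines the two preceding facts so that the shape of \<open>t\<close> disappears from
  later arguments.\<close>

lemma ex_one_sided_bound_snoc:
  assumes s: "s \<in> S" and b: "b \<in> S" and sb: "lex_less i s b"
  obtains t where "t \<in> S" "lex_less i s t"
    "\<And>u j x. u \<in> S \<Longrightarrow> lex_less i s (snoc u j) \<Longrightarrow> lex_less i (snoc u j) t \<Longrightarrow> u \<subseteq>\<^sub>m x \<Longrightarrow>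
      lex_less i s x \<and> lex_less i x b"
proof -
  obtain t where t: "t \<in> S" "snoc s i \<subseteq>\<^sub>m t"
    "\<And>\<beta>. ht s < \<beta> \<Longrightarrow> t \<beta> \<noteq> None \<Longrightarrow> t \<beta> = Some (\<not> i)" "\<And>x. t \<subseteq>\<^sub>m x \<Longrightarrow> lex_less i x b"
    using ex_one_sided_bound[OF s b sb] by auto
  show ?thesis
  proof (rule that[of t])
    show "t \<in> S" "lex_less i s t"
      using t(1) lex_snoc[OF two_lt[OF s] t(2)] by auto
    show "lex_less i s x \<and> lex_less i x b"
      if "u \<in> S" "lex_less i s (snoc u j)" "lex_less i (snoc u j) t" "u \<subseteq>\<^sub>m x" for u j x
      using snoc_between_imp_cone_between[OF s t(1,2) t(3,4) that] by blast
  qed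
qed

section \<open>Intervals, cones and separation in the order topology\<close>

abbreviation tree_topology :: "bseq topology"
  where "tree_topology \<equiv> order_topology_on S (\<prec>)"

lemma topspace_tree_topology [simp]: "topspace tree_topology = S"
  by (auto simp: order_topology_on_def)

lemma openin_ray: "a \<in> S \<Longrightarrow> openin tree_topology {x \<in> S. lex_less i a x}"
  using lex_not[of True] unfolding order_topology_on_def prec_eq_lex
  by (cases i) (auto intro!: topology_generated_by_Basis)

text \<open>Intervals with both ends in \<open>S\<close> suffice because no node is extreme:
  \<open>snoc y False\<close> precedes \<open>y\<close> and \<open>snoc y True\<close> follows it.
  This supplies the missing ends of rays and of the whole space.\<close>

lemma openin_tree_topologyE:
  assumes "openin tree_topology W" "x \<in> W"
  obtains a b where "a \<in> S" "b \<in> S" "lex_less True a x" "lex_less True x b"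
    "{y \<in> S. lex_less True a y \<and> lex_less True y b} \<subseteq> W"
proof -
  define I where "I = (\<lambda>a b. {y \<in> S. lex_less True a y \<and> lex_less True y b})"
  have endless: "lex_less True (snoc y False) y \<and> lex_less True y (snoc y True)" if "y \<in> S" for y
    using lex_snoc[OF two_lt[OF that], of False "snoc y False"]
      lex_snoc[OF two_lt[OF that], of True "snoc y True"] lex_not[of True] by simp
  have "generate_topology_on (insert S ((\<lambda>a. {x \<in> S. lex_less True a x}) ` S \<union>
      (\<lambda>a. {x \<in> S. lex_less True x a}) ` S)) W"
    using openin_topology_generated_by[OF assms(1)[unfolded order_topology_on_def prec_eq_lex]] .
  then have "\<forall>x\<in>W. \<exists>a\<in>S. \<exists>b\<in>S. x \<in> I a b \<and> I a b \<subseteq> W"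
  proof induction
    case Empty
    show ?case by simp
  next
    case (Int A B)
    show ?case
    proof
      fix x assume x: "x \<in> A \<inter> B"
      obtain a b where ab: "a \<in> S" "b \<in> S" "x \<in> I a b" "I a b \<subseteq> A"
        using Int.IH(1) x by blast
      obtain c d where cd: "c \<in> S" "d \<in> S" "x \<in> I c d" "I c d \<subseteq> B"
        using Int.IH(2) x by blast
      obtain l where l: "l \<in> S" "lex_less True l x"
        "\<And>y. lex_less True l y \<Longrightarrow> lex_less True a y \<and> lex_less True c y"
        using ab(1,3) cd(1,3) ex_tighter_bound[of True a x c] unfolding I_def by blast
      \<comment> \<open>Upper bounds are lower bounds of the converse order, hence the bit
        \<open>False\<close>.\<close>
      obtain r where r: "r \<in> S" "lex_less True x r"
        "\<And>y. lex_less True y r \<Longrightarrow> lex_less True y b \<and> lex_less True y d"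
        using ab(2,3) cd(2,3) ex_tighter_bound[of False b x d] lex_not[of True]
        unfolding I_def by auto
      have "x \<in> I l r" "I l r \<subseteq> A \<inter> B"
        using ab cd l r unfolding I_def by auto
      then show "\<exists>a\<in>S. \<exists>b\<in>S. x \<in> I a b \<and> I a b \<subseteq> A \<inter> B"
        using l(1) r(1) by blast
    qed
  next
    case (UN K)
    then show ?case by (meson UnionE Union_upper subset_trans)
  next
    case (Basis W)
    show ?case
    proof
      fix x assume x: "x \<in> W"
      then have xS: "x \<in> S" using Basis by auto
      from Basis consider "W = S" | a where "a \<in> S" "W = {x \<in> S. lex_less True a x}"
        | b where "b \<in> S" "W = {x \<in> S. lex_less True x b}" by auto
      then show "\<exists>a\<in>S. \<exists>b\<in>S. x \<in> I a b \<and> I a b \<subseteq> W"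
      proof cases
        case 1
        then show ?thesis using endless[OF xS] snoc[OF xS] xS unfolding I_def by blast
      next
        case 2
        then show ?thesis using endless[OF xS] snoc[OF xS] x unfolding I_def by blast
      next
        case 3
        then show ?thesis using endless[OF xS] snoc[OF xS] x unfolding I_def by blast
      qed
    qed
  qed
  then show ?thesis using assms(2) that unfolding I_def by blast
qed

lemma openin_interval:
  assumes "a \<in> S" "b \<in> S"
  shows "openin tree_topology {y \<in> S. lex_less i a y \<and> lex_less i y b}"
proof -
  have "{y \<in> S. lex_less i a y \<and> lex_less i y b} =
      {y \<in> S. lex_less i a y} \<inter> {y \<in> S. lex_less (\<not> i) b y}"
    by auto
  then show ?thesis
    using openin_Int[OF openin_ray[OF assms(1), of i] openin_ray[OF assms(2), of "\<not> i"]]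
    by (simp only:)
qed

text \<open>Around each \<open>x\<close> the interval from \<open>snoc x False\<close> to
  \<open>snoc x True\<close> stays inside the cone of \<open>x\<close>: by convexity, a point
  outside that cone lies on the same side of both ends.\<close>

lemma openin_cone:
  assumes "t \<in> S"
  shows "openin tree_topology (cone t)"
proof (subst openin_subopen, intro ballI)
  fix x assume x: "x \<in> cone t"
  then have xS: "x \<in> S" and tx: "t \<subseteq>\<^sub>m x" unfolding cone_def by auto
  note x2 = two_lt[OF xS]
  let ?I = "{y \<in> S. lex_less True (snoc x False) y \<and> lex_less True y (snoc x True)}"
  have "x \<in> ?I"
    using xS lex_snoc[OF x2, of False "snoc x False"] lex_snoc[OF x2, of True "snoc x True"]
      lex_not[of True] by simp
  moreover have "?I \<subseteq> cone t"
  proof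
    fix y assume y: "y \<in> ?I"
    have "x \<subseteq>\<^sub>m y"
    proof (rule ccontr)
      assume "\<not> x \<subseteq>\<^sub>m y"
      then have "lex_less True (snoc x True) y"
        using lex_cone[OF x2 map_le_snoc[OF x2] map_le_snoc[OF x2]] y by blast
      then show False using y lex_asym by blast
    qed
    then show "y \<in> cone t" using y tx map_le_trans unfolding cone_def by blast
  qed
  moreover have "openin tree_topology ?I"
    using openin_interval[OF snoc[OF xS] snoc[OF xS]] .
  ultimately show "\<exists>T. openin tree_topology T \<and> x \<in> T \<and> T \<subseteq> cone t"
    by blast
qed

text \<open>Successors close to \<open>s\<close> drag the whole cones of their parents along. The
  set \<open>W'\<close> is the interval between the one-sided bounds on the two sides of
  \<open>s\<close>; the excluded case \<open>snoc u j = s\<close> will cost at most one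
  node.\<close>

lemma ex_refined_neighbourhood:
  assumes W: "openin tree_topology W" "s \<in> W"
  obtains W' where "openin tree_topology W'" "s \<in> W'"
    "\<And>u j. u \<in> S \<Longrightarrow> snoc u j \<in> W' \<Longrightarrow> snoc u j \<noteq> s \<Longrightarrow> cone u \<subseteq> W"
proof -
  have s: "s \<in> S" using openin_subset[OF W(1)] W(2) by auto
  obtain a b where ab: "a \<in> S" "b \<in> S" "lex_less True a s" "lex_less True s b"
    "{y \<in> S. lex_less True a y \<and> lex_less True y b} \<subseteq> W"
    using W by (rule openin_tree_topologyE)
  obtain r where r: "r \<in> S" "lex_less True s r"
    "\<And>u j x. u \<in> S \<Longrightarrow> lex_less True s (snoc u j) \<Longrightarrow> lex_less True (snoc u j) r \<Longrightarrow> u \<subseteq>\<^sub>m x \<Longrightarrow>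
      lex_less True s x \<and> lex_less True x b"
    using ex_one_sided_bound_snoc[OF s ab(2,4)] by blast
  have "lex_less False s a" using ab(3) lex_not[of True] by simp
  then obtain l where l: "l \<in> S" "lex_less False s l"
    "\<And>u j x. u \<in> S \<Longrightarrow> lex_less False s (snoc u j) \<Longrightarrow> lex_less False (snoc u j) l \<Longrightarrow> u \<subseteq>\<^sub>m x \<Longrightarrow>
      lex_less False s x \<and> lex_less False x a"
    using ex_one_sided_bound_snoc[OF s ab(1)] by blast
  have F: "lex_less False x y = lex_less True y x" for x y
    using lex_not[of True] by simp
  show ?thesis
  proof (rule that)
    show "openin tree_topology {y \<in> S. lex_less True l y \<and> lex_less True y r}"
      using openin_interval[OF l(1) r(1)] .
    show "s \<in> {y \<in> S. lex_less True l y \<and> lex_less True y r}"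
      using s l(2) r(2) F by simp
    show "cone u \<subseteq> W"
      if u: "u \<in> S" "snoc u j \<in> {y \<in> S. lex_less True l y \<and> lex_less True y r}" "snoc u j \<noteq> s"
      for u j
    proof
      fix x assume "x \<in> cone u"
      then have x: "x \<in> S" "u \<subseteq>\<^sub>m x" unfolding cone_def by auto
      have "lex_less True s (snoc u j) \<or> lex_less True (snoc u j) s"
        using u(3) lex_total by blast
      then have "lex_less True a x \<and> lex_less True x b"
      proof
        assume "lex_less True s (snoc u j)"
        then show ?thesis using r(3)[OF u(1), of j x] u(2) x(2) ab(3) lex_trans by blast
      next
        assume "lex_less True (snoc u j) s"
        then show ?thesis using l(3)[OF u(1), of j x] u(2) x(2) ab(4) lex_trans unfolding F by blast
      qed
      then show "x \<in> W" using ab(5) x(1) by blast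
    qed
  qed
qed

text \<open>A one-sided bound supplies a node \<open>t\<close> strictly between \<open>s\<close> and
  \<open>v\<close>; the two open rays at \<open>t\<close> separate them.\<close>

lemma disjoint_neighbourhoods:
  assumes "s \<in> S" "v \<in> S" "s \<noteq> v"
  obtains W N where "openin tree_topology W" "openin tree_topology N" "s \<in> W" "v \<in> N" "W \<inter> N = {}"
proof -
  obtain i where i: "lex_less i s v"
    using lex_total[OF assms(3), of True] lex_not[of True] by metis
  then obtain t where t: "t \<in> S" "snoc s i \<subseteq>\<^sub>m t" "lex_less i t v"
    using ex_one_sided_bound[OF assms(1,2)] by (meson map_le_refl)
  show ?thesis
  proof (rule that)
    show "openin tree_topology {x \<in> S. lex_less (\<not> i) t x}" "openin tree_topology {x \<in> S. lex_less i t x}"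
      using openin_ray[OF t(1)] by blast+
    show "s \<in> {x \<in> S. lex_less (\<not> i) t x}"
      using lex_snoc[OF two_lt[OF assms(1)] t(2)] assms(1) by simp
    show "v \<in> {x \<in> S. lex_less i t x}"
      using assms(2) t(3) by simp
    show "{x \<in> S. lex_less (\<not> i) t x} \<inter> {x \<in> S. lex_less i t x} = {}"
      using lex_asym by auto
  qed
qed

section \<open>Lindelof subspaces of the tree\<close>

lemma Lindelof_subtopology_tree_topology:
  assumes antichain: "\<And>A. A \<subseteq> S \<Longrightarrow> pairwise (\<lambda>s t. \<not> s \<subseteq>\<^sub>m t \<and> \<not> t \<subseteq>\<^sub>m s) A \<Longrightarrow> countable A"
  shows "Lindelof_space (subtopology tree_topology A)"
  unfolding Lindelof_space_subtopology
proof (intro allI impI)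
  fix \<U>
  assume "(\<forall>U\<in>\<U>. openin tree_topology U) \<and> topspace tree_topology \<inter> A \<subseteq> \<Union> \<U>"
  then have op: "\<And>U. U \<in> \<U> \<Longrightarrow> openin tree_topology U" and cov: "S \<inter> A \<subseteq> \<Union> \<U>" by auto
  define T0 where "T0 = {t \<in> S. \<exists>W\<in>\<U>. cone t \<subseteq> W}"
  define M where "M = {t \<in> T0. \<forall>u\<in>T0. u \<subseteq>\<^sub>m t \<longrightarrow> u = t}"
  have MS: "M \<subseteq> S" unfolding M_def T0_def by blast
  have "countable M"
  proof (rule antichain[OF MS])
    show "pairwise (\<lambda>s t. \<not> s \<subseteq>\<^sub>m t \<and> \<not> t \<subseteq>\<^sub>m s) M"
      unfolding pairwise_def M_def by blast
  qed
  have minimal: "\<exists>m\<in>M. m \<subseteq>\<^sub>m t" if "t \<in> T0" for t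
  proof -
    have tS: "t \<in> S" using that unfolding T0_def by blast
    \<comment> \<open>Initial segments of \<open>t\<close> are indexed by ordinals, so the
      well-order on \<open>omega1\<close> yields a shortest one in \<open>T0\<close>.\<close>
    define P where "P = (\<lambda>\<alpha>. t |` {..<\<alpha>} \<in> T0)"
    have "t = t |` {..<ht t}"
      using restrict_eq_if_map_le[OF two_lt[OF tS] map_le_refl] .
    then have "P (ht t)" using that unfolding P_def by simp
    then obtain \<alpha> where a: "P \<alpha>" "\<forall>\<beta><\<alpha>. \<not> P \<beta>"
      using exists_least_iff[of P] by auto
    define m where "m = t |` {..<\<alpha>}"
    have mt: "m \<subseteq>\<^sub>m t" unfolding m_def by (auto simp: map_le_def)
    have m0: "m \<in> T0" using a(1) unfolding P_def m_def .
    have "u = m" if u: "u \<in> T0" "u \<subseteq>\<^sub>m m" for u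
    proof -
      have u2: "u \<in> two_lt_omega1" using u(1) two_lt unfolding T0_def by blast
      have "u = t |` {..<ht u}"
        using restrict_eq_if_map_le[OF u2 map_le_trans[OF u(2) mt]] .
      then have "P (ht u)" using u(1) unfolding P_def by simp
      then have "\<alpha> \<le> ht u" using a(2) by (meson linorder_not_le)
      then have "m \<subseteq>\<^sub>m u"
        unfolding m_def
        by (subst \<open>u = t |` {..<ht u}\<close>) (auto simp: map_le_def restrict_map_def split: if_splits)
      then show ?thesis using u(2) map_le_antisym by blast
    qed
    then show ?thesis using mt m0 unfolding M_def by blast
  qed
  \<comment> \<open>The exceptional points are the initial segments of minimal nodes. Each node has
    only countably many of them because its height is a countable ordinal.\<close>
  define R where "R = (\<Union>m\<in>M. (\<lambda>\<alpha>. m |` {..<\<alpha>}) ` {..ht m})"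
  have "countable {..\<alpha> :: omega1}" for \<alpha>
    using countable_lessThan_omega1[of \<alpha>] by (simp add: ivl_disj_un_singleton(2)[symmetric])
  then have "countable R" unfolding R_def using \<open>countable M\<close> by auto
  have "\<forall>m\<in>M. \<exists>W\<in>\<U>. cone m \<subseteq> W" unfolding M_def T0_def by blast
  then obtain f where f: "\<And>m. m \<in> M \<Longrightarrow> f m \<in> \<U> \<and> cone m \<subseteq> f m" by metis
  have "\<forall>x\<in>S \<inter> A. \<exists>W\<in>\<U>. x \<in> W" using cov by blast
  then obtain g where g: "\<And>x. x \<in> S \<inter> A \<Longrightarrow> g x \<in> \<U> \<and> x \<in> g x" by metis
  have "S \<inter> A \<subseteq> \<Union> (f ` M \<union> g ` (R \<inter> (S \<inter> A)))"
  proof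
    fix x assume x: "x \<in> S \<inter> A"
    then have xS: "x \<in> S" by simp
    obtain W where W: "W \<in> \<U>" "x \<in> W" using cov x by blast
    obtain a b where ab: "a \<in> S" "b \<in> S" "lex_less True a x" "lex_less True x b"
      "{y \<in> S. lex_less True a y \<and> lex_less True y b} \<subseteq> W"
      using op[OF W(1)] W(2) by (rule openin_tree_topologyE)
    \<comment> \<open>The neighbourhood \<open>W\<close> need not contain the cone of
      \<open>x\<close>, but it contains the cone of some node above \<open>snoc x True\<close>; that
      node belongs to \<open>T0\<close> and leads to a minimal one.\<close>
    obtain t where t: "t \<in> S" "snoc x True \<subseteq>\<^sub>m t" "\<And>y. t \<subseteq>\<^sub>m y \<Longrightarrow> lex_less True y b"
      using ex_one_sided_bound[OF xS ab(2,4)] by blast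
    have "cone t \<subseteq> W"
    proof
      fix y assume "y \<in> cone t"
      then have y: "y \<in> S" "t \<subseteq>\<^sub>m y" unfolding cone_def by auto
      have "lex_less True x y"
        using lex_snoc[OF two_lt[OF xS] map_le_trans[OF t(2) y(2)]] .
      then show "y \<in> W" using t(3)[OF y(2)] y(1) ab(3,5) lex_trans by blast
    qed
    then obtain m where m: "m \<in> M" "m \<subseteq>\<^sub>m t"
      using minimal t(1) W(1) unfolding T0_def by blast
    have mS: "m \<in> S" using m(1) MS by blast
    have "x \<subseteq>\<^sub>m t" using map_le_snoc[OF two_lt[OF xS]] t(2) by (rule map_le_trans)
    \<comment> \<open>Both \<open>m\<close> and \<open>x\<close> are initial segments of
      \<open>t\<close>, hence comparable: either the member chosen for the cone of \<open>m\<close>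
      covers \<open>x\<close>, or \<open>x\<close> is an exceptional point with a member of its
      own.\<close>
    then consider "m \<subseteq>\<^sub>m x" | "x \<subseteq>\<^sub>m m"
      using map_le_linear[OF two_lt[OF mS] two_lt[OF xS] m(2)] by blast
    then show "x \<in> \<Union> (f ` M \<union> g ` (R \<inter> (S \<inter> A)))"
    proof cases
      case 1
      then have "x \<in> cone m" using xS unfolding cone_def by blast
      then show ?thesis using f[OF m(1)] m(1) by blast
    next
      case 2
      then have "x = m |` {..<ht x}" by (rule restrict_eq_if_map_le[OF two_lt[OF xS]])
      moreover have "ht x \<le> ht m"
        using 2 apply_eq_None_iff[OF two_lt[OF xS], of "ht m"] apply_eq_None_iff[OF two_lt[OF mS], of "ht m"]
          apply_eqI_map_le[OF 2, of "ht m"] by fastforce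
      ultimately have "x \<in> R" unfolding R_def using m(1) by blast
      then show ?thesis using g[OF x] x by blast
    qed
  qed
  moreover have "f ` M \<union> g ` (R \<inter> (S \<inter> A)) \<subseteq> \<U>" using f g by blast
  moreover have "countable (f ` M \<union> g ` (R \<inter> (S \<inter> A)))"
    using \<open>countable M\<close> \<open>countable R\<close> by auto
  ultimately show "\<exists>\<V>. countable \<V> \<and> \<V> \<subseteq> \<U> \<and> topspace tree_topology \<inter> A \<subseteq> \<Union> \<V>"
    by (metis topspace_tree_topology)
qed

section \<open>Immediate successors\<close>

lemma snoc_in_parts:
  assumes "s \<in> S"
  shows "snoc s False \<in> U_part S" "snoc s True \<in> V_part S"
proof -
  have d: "dom (snoc s i) = {..ht s}" for i
  proof -
    have "snoc s i \<beta> \<noteq> None \<longleftrightarrow> \<beta> \<le> ht s" for \<beta>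
      using apply_eq_None_iff[OF two_lt[OF assms], of \<beta>] by (auto simp: snoc_apply)
    then show ?thesis unfolding dom_def by auto
  qed
  then show "snoc s False \<in> U_part S"
    using snoc[OF assms] unfolding U_part_def succ_part_def by (auto simp: snoc_apply)
  have "snoc s True \<notin> U_part S"
    unfolding U_part_def using d[of True] by (auto simp: snoc_apply)
  then show "snoc s True \<in> V_part S"
    using snoc[OF assms] d[of True] unfolding V_part_def succ_part_def by blast
qed

text \<open>The height is determined by where the extended sequence ends, and erasing the last entry
  returns the node. This makes the cellular family disjoint.\<close>

lemma snoc_inject:
  assumes "s \<in> S" "t \<in> S" "snoc s i = snoc t i"
  shows "s = t"
proof -
  have "ht s = ht t"
  proof (rule order_antisym)
    show "ht s \<le> ht t"
      using arg_cong[OF assms(3), of "\<lambda>f. f (ht s)"] apply_eq_None_iff[OF two_lt[OF assms(2)], of "ht s"]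
      by (auto simp: snoc_apply split: if_splits)
    show "ht t \<le> ht s"
      using arg_cong[OF assms(3), of "\<lambda>f. f (ht t)"] apply_eq_None_iff[OF two_lt[OF assms(1)], of "ht t"]
      by (auto simp: snoc_apply split: if_splits)
  qed
  then show ?thesis
    using assms(3) apply_eq_None_iff[OF two_lt[OF assms(1)], of "ht s"]
      apply_eq_None_iff[OF two_lt[OF assms(2)], of "ht t"]
    unfolding snoc_def by (metis fun_upd_triv fun_upd_upd order_refl)
qed

end

section \<open>The Alexandroff double\<close>

lemma topspace_Alexandroff_double [simp]:
  "topspace (Alexandroff_double Z) = topspace Z \<times> UNIV"
proof (rule antisym)
  show "topspace (Alexandroff_double Z) \<subseteq> topspace Z \<times> UNIV"
    using openin_topspace[of "Alexandroff_double Z"] unfolding openin_Alexandroff_double by blast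
  have "openin (Alexandroff_double Z) (topspace Z \<times> UNIV)"
    unfolding openin_Alexandroff_double by (auto intro!: exI[of _ "topspace Z"])
  then show "topspace Z \<times> UNIV \<subseteq> topspace (Alexandroff_double Z)"
    by (rule openin_subset)
qed

text \<open>A countable subcover of the base by sets \<open>G x\<close> lifts to the double, except
  perhaps for the points \<open>(x, True)\<close> removed at the countably many centres
  \<open>x\<close> in \<open>C\<close>. Each of these receives one further member
  \<open>H x\<close>.\<close>

lemma Lindelof_space_Alexandroff_double:
  assumes Z: "Lindelof_space Z"
  shows "Lindelof_space (Alexandroff_double Z)"
  unfolding Lindelof_space_def
proof (intro allI impI)
  fix \<U>
  assume "(\<forall>U\<in>\<U>. openin (Alexandroff_double Z) U) \<and> \<Union> \<U> = topspace (Alexandroff_double Z)"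
  then have op: "\<And>T. T \<in> \<U> \<Longrightarrow> openin (Alexandroff_double Z) T"
    and cov: "\<Union> \<U> = topspace Z \<times> UNIV" by auto
  define P where "P = (\<lambda>x T W. T \<in> \<U> \<and> openin Z W \<and> x \<in> W \<and> W \<times> UNIV - {(x, True)} \<subseteq> T)"
  have "\<exists>T W. P x T W" if "x \<in> topspace Z" for x
  proof -
    have "(x, False) \<in> \<Union> \<U>" unfolding cov using that by simp
    then obtain T where T: "T \<in> \<U>" "(x, False) \<in> T" by blast
    then obtain W where "openin Z W" "(x, False) \<in> W \<times> UNIV - {(x, True)}"
      "W \<times> UNIV - {(x, True)} \<subseteq> T"
      using op[OF T(1)] unfolding openin_Alexandroff_double by blast
    then show ?thesis using T(1) unfolding P_def by auto
  qed
  then obtain F G where "\<And>x. x \<in> topspace Z \<Longrightarrow> P x (F x) (G x)"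
    by metis
  then have FG: "F x \<in> \<U> \<and> openin Z (G x) \<and> x \<in> G x \<and> G x \<times> UNIV - {(x, True)} \<subseteq> F x"
    if "x \<in> topspace Z" for x
    using that unfolding P_def by blast
  have G_cover: "\<Union> (G ` topspace Z) = topspace Z"
    using FG openin_subset by blast
  have G_open: "openin Z W" if "W \<in> G ` topspace Z" for W
    using that FG by blast
  have "\<exists>\<V>. countable \<V> \<and> \<V> \<subseteq> G ` topspace Z \<and> \<Union> \<V> = topspace Z"
    by (rule Lindelof_spaceD[OF Z G_open G_cover])
  then obtain \<V> where V: "countable \<V>" "\<V> \<subseteq> G ` topspace Z" "\<Union> \<V> = topspace Z"
    by metis
  then obtain C where C: "countable C" "C \<subseteq> topspace Z" "\<V> = G ` C"
    by (meson countable_subset_image)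
  have "\<forall>x\<in>topspace Z. (x, True) \<in> \<Union> \<U>" unfolding cov by simp
  then obtain H where H: "\<And>x. x \<in> topspace Z \<Longrightarrow> H x \<in> \<U> \<and> (x, True) \<in> H x"
    unfolding Union_iff by metis
  have "topspace Z \<times> UNIV \<subseteq> \<Union> (F ` C \<union> H ` C)"
  proof
    fix p :: "'a \<times> bool" assume p: "p \<in> topspace Z \<times> UNIV"
    then have "fst p \<in> \<Union> (G ` C)" using V(3) C(3) by auto
    then obtain x where x: "x \<in> C" "fst p \<in> G x" by blast
    show "p \<in> \<Union> (F ` C \<union> H ` C)"
    proof (cases "p = (x, True)")
      case True
      then show ?thesis using H[of x] x(1) C(2) by blast
    next
      case False
      then have "p \<in> G x \<times> UNIV - {(x, True)}" using x(2) by (cases p) auto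
      then show ?thesis using FG[of x] x(1) C(2) by blast
    qed
  qed
  moreover have sub: "F ` C \<union> H ` C \<subseteq> \<U>" using FG H C(2) by blast
  ultimately have "\<Union> (F ` C \<union> H ` C) = topspace (Alexandroff_double Z)"
    using Union_mono[OF sub] unfolding cov topspace_Alexandroff_double by (simp only: set_eq_subset)
  then show "\<exists>\<V>. countable \<V> \<and> \<V> \<subseteq> \<U> \<and> \<Union> \<V> = topspace (Alexandroff_double Z)"
    using sub C(1) by (intro exI[of _ "F ` C \<union> H ` C"]) auto
qed

section \<open>The product with the double\<close>

theorem theorem4p6:
  fixes S :: "bseq set"
  assumes "full_branching_Souslin_tree S"
  defines "U \<equiv> subtopology (order_topology_on S (\<prec>)) (U_part S)"
    and "V \<equiv> subtopology (order_topology_on S (\<prec>)) (V_part S)"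
  defines "X \<equiv> Alexandroff_double U"
  shows "Lindelof_space X \<and> hereditarily Lindelof_space V \<and>
         \<not> cellular_Lindelof_space (prod_topology X V)"
proof -
  have tree: "S \<subseteq> two_lt_omega1" "uncountable S" "\<forall>s\<in>S. \<forall>\<alpha>. s |` {..<\<alpha>} \<in> S"
    "\<forall>s\<in>S. snoc s False \<in> S \<and> snoc s True \<in> S"
    "\<forall>A\<subseteq>S. pairwise (\<lambda>s t. \<not> s \<subseteq>\<^sub>m t \<and> \<not> t \<subseteq>\<^sub>m s) A \<longrightarrow> countable A"
    using assms(1) unfolding full_branching_Souslin_tree_def by - (elim conjE, assumption)+
  interpret branching_tree S
  proof
    show "S \<subseteq> two_lt_omega1" by (rule tree(1))
    show "s |` {..<\<alpha>} \<in> S" if "s \<in> S" for s \<alpha> using tree(3) that by blast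
    show "snoc s i \<in> S" if "s \<in> S" for s i using tree(4) that by (cases i) auto
  qed
  have antichain: "countable A" if "A \<subseteq> S" "pairwise (\<lambda>s t. \<not> s \<subseteq>\<^sub>m t \<and> \<not> t \<subseteq>\<^sub>m s) A" for A
    using tree(5)[rule_format, OF that] .
  note Lindelof = Lindelof_subtopology_tree_topology[OF antichain]
  have "Lindelof_space X"
    unfolding X_def U_def by (rule Lindelof_space_Alexandroff_double[OF Lindelof])
  moreover have "hereditarily Lindelof_space V"
    unfolding hereditarily V_def subtopology_subtopology using Lindelof by blast
  moreover have "\<not> cellular_Lindelof_space (prod_topology X V)"
  proof
    assume cL: "cellular_Lindelof_space (prod_topology X V)"
    have top_U: "topspace U = U_part S" and top_V: "topspace V = V_part S"
      unfolding U_def V_def U_part_def V_part_def succ_part_def by auto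
    \<comment> \<open>The singleton has no point with bit \<open>False\<close>, so the neighbourhood
      condition is vacuous.\<close>
    have isolated: "openin X {(x, True)}" if "x \<in> U_part S" for x
      unfolding X_def openin_Alexandroff_double using that top_U by auto
    \<comment> \<open>The isolated first coordinate determines \<open>s\<close>, which gives
      disjointness; \<open>snoc s True\<close> shows that the second factor is nonempty.\<close>
    define P where "P = (\<lambda>s. {(snoc s False, True)} \<times> (V_part S \<inter> cone s))"
    have P_open: "openin (prod_topology X V) (P s)" if s: "s \<in> S" for s
    proof -
      have "openin V (cone s \<inter> V_part S)"
        unfolding V_def using openin_cone[OF s] by (rule openin_subtopology_Int)
      then show ?thesis
        unfolding P_def openin_prod_Times_iff
        using isolated[OF snoc_in_parts(1)[OF s]] by (simp add: Int_commute)
    qed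
    have P_nonempty: "P s \<noteq> {}" if s: "s \<in> S" for s
      using snoc_in_parts(2)[OF s] snoc[OF s] map_le_snoc[OF two_lt[OF s]]
      unfolding P_def cone_def by blast
    have P_disjoint: "pairwise disjnt (P ` S)"
      unfolding pairwise_def disjnt_def P_def using snoc_inject by blast
    have "\<exists>L\<subseteq>topspace (prod_topology X V).
        Lindelof_space (subtopology (prod_topology X V) L) \<and> (\<forall>W\<in>P ` S. L \<inter> W \<noteq> {})"
    proof (rule cL[unfolded cellular_Lindelof_space_def, rule_format], intro conjI ballI)
      show "openin (prod_topology X V) W" "W \<noteq> {}" if "W \<in> P ` S" for W
        using that P_open P_nonempty by blast+
      show "pairwise disjnt (P ` S)" by (rule P_disjoint)
    qed
    then obtain L where L: "L \<subseteq> topspace (prod_topology X V)"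
      "Lindelof_space (subtopology (prod_topology X V) L)" "\<And>s. s \<in> S \<Longrightarrow> L \<inter> P s \<noteq> {}"
      by auto
    have "\<forall>s\<in>S. \<exists>v. v \<in> V_part S \<inter> cone s \<and> ((snoc s False, True), v) \<in> L"
      using L(3) unfolding P_def by blast
    then obtain v where v: "\<And>s. s \<in> S \<Longrightarrow> v s \<in> V_part S \<inter> cone s \<and> ((snoc s False, True), v s) \<in> L"
      by metis
    define q where "q = (\<lambda>s. ((snoc s False, True), v s))"
    \<comment> \<open>Open sets that contain \<open>q s\<close> for only countably many
      \<open>s\<close>. If they cover \<open>L\<close>, countably many of them do, and the
      uncountable \<open>S\<close> becomes a countable union of countable sets.\<close>
    define \<O> where "\<O> = {T. openin (prod_topology X V) T \<and> countable {s \<in> S. q s \<in> T}}"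
    have parents: "countable {s \<in> S. snoc s False = x}" for x
    proof (rule countable_finite, rule inj_on_finite)
      show "inj_on (\<lambda>s. snoc s False) {s \<in> S. snoc s False = x}"
        using snoc_inject unfolding inj_on_def by blast
      show "(\<lambda>s. snoc s False) ` {s \<in> S. snoc s False = x} \<subseteq> {x}"
        by auto
    qed simp
    have "\<exists>T\<in>\<O>. p \<in> T" if p: "p \<in> L" for p
    proof -
      obtain x i y where pe: "p = ((x, i), y)" by (metis surj_pair)
      have x: "x \<in> U_part S" and y: "y \<in> V_part S"
        using p L(1) top_U top_V unfolding pe X_def by auto
      show ?thesis
      proof (cases i)
        case True
        \<comment> \<open>The slice over an isolated point contains \<open>q s\<close> for at most
          one \<open>s\<close>.\<close>
        have "openin (prod_topology X V) ({(x, True)} \<times> V_part S)"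
          unfolding openin_prod_Times_iff using isolated[OF x] openin_topspace[of V] top_V by simp
        moreover have "countable {s \<in> S. q s \<in> {(x, True)} \<times> V_part S}"
          by (rule countable_subset[OF _ parents[of x]]) (auto simp: q_def)
        ultimately have "{(x, True)} \<times> V_part S \<in> \<O>" unfolding \<O>_def by simp
        moreover have "p \<in> {(x, True)} \<times> V_part S" using y True pe by simp
        ultimately show ?thesis by (rule bexI[rotated])
      next
        case False
        \<comment> \<open>Disjointness of the two parts keeps \<open>(x, y)\<close> off the
          diagonal, so \<open>x\<close> and \<open>y\<close> can be separated.\<close>
        have xy: "x \<in> S" "y \<in> S" "x \<noteq> y"
          using x y unfolding U_part_def V_part_def succ_part_def by auto
        obtain W N where WN: "openin tree_topology W" "openin tree_topology N" "x \<in> W" "y \<in> N" "W \<inter> N = {}"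
          using xy by (rule disjoint_neighbourhoods)
        obtain W' where W': "openin tree_topology W'" "x \<in> W'"
          "\<And>u j. u \<in> S \<Longrightarrow> snoc u j \<in> W' \<Longrightarrow> snoc u j \<noteq> x \<Longrightarrow> cone u \<subseteq> W"
          using WN(1,3) by (rule ex_refined_neighbourhood) blast
        let ?A = "W' \<inter> U_part S" and ?B = "N \<inter> V_part S"
        have A: "openin U ?A" and B: "openin V ?B"
          unfolding U_def V_def using W'(1) WN(2) by (auto intro: openin_subtopology_Int)
        have "openin X (?A \<times> UNIV)"
          unfolding X_def openin_Alexandroff_double using A openin_subset[OF A] by blast
        then have "openin (prod_topology X V) ((?A \<times> UNIV) \<times> ?B)"
          unfolding openin_prod_Times_iff using B by blast
        moreover have "countable {s \<in> S. q s \<in> (?A \<times> UNIV) \<times> ?B}"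
        proof (rule countable_subset[OF _ parents[of x]], rule subsetI)
          fix s assume "s \<in> {s \<in> S. q s \<in> (?A \<times> UNIV) \<times> ?B}"
          then have s: "s \<in> S" "snoc s False \<in> W'" "v s \<in> N"
            unfolding q_def by auto
          have "v s \<in> cone s" using v s(1) by blast
          \<comment> \<open>Otherwise the cone of \<open>s\<close>, and with it \<open>v s\<close>,
            would lie in \<open>W\<close>, which is disjoint from \<open>N\<close>.\<close>
          then have "snoc s False = x"
            using W'(3)[OF s(1,2)] s(3) WN(5) by blast
          then show "s \<in> {s \<in> S. snoc s False = x}" using s(1) by blast
        qed
        ultimately have "(?A \<times> UNIV) \<times> ?B \<in> \<O>" unfolding \<O>_def by simp
        moreover have "p \<in> (?A \<times> UNIV) \<times> ?B" using pe x y W'(2) WN(4) by simp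
        ultimately show ?thesis by (rule bexI[rotated])
      qed
    qed
    then have "L \<subseteq> \<Union> \<O>" by blast
    moreover have "\<forall>T\<in>\<O>. openin (prod_topology X V) T" unfolding \<O>_def by simp
    ultimately have "\<exists>\<V>. countable \<V> \<and> \<V> \<subseteq> \<O> \<and> L \<subseteq> \<Union> \<V>"
      using L(2)[unfolded Lindelof_space_subtopology_subset[OF L(1)], rule_format, of \<O>] by simp
    then obtain \<V> where V: "countable \<V>" "\<V> \<subseteq> \<O>" "L \<subseteq> \<Union> \<V>"
      by metis
    have "S \<subseteq> (\<Union>T\<in>\<V>. {s \<in> S. q s \<in> T})"
    proof
      fix s assume s: "s \<in> S"
      then have "q s \<in> \<Union> \<V>" using v[OF s] V(3) unfolding q_def by (auto dest: subsetD)
      then show "s \<in> (\<Union>T\<in>\<V>. {s \<in> S. q s \<in> T})" using s by simp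
    qed
    moreover have "countable (\<Union>T\<in>\<V>. {s \<in> S. q s \<in> T})"
    proof (rule countable_UN[OF V(1)])
      show "countable {s \<in> S. q s \<in> T}" if "T \<in> \<V>" for T
        using subsetD[OF V(2) that] unfolding \<O>_def by simp
    qed
    ultimately show False using tree(2) countable_subset by blast
  qed
  ultimately show ?thesis by blast
qed

end
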